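(* Let $\theta,\eta\in\mathbb R$. If there is $A\in{\rm PGL}_2(\mathbb Z)$ with $A(\theta)=\eta$ (action by fractional linear transformations), then ${\rm Spec}(\theta)={\rm Spec}(\eta)$.
   Context: Fix a nonprincipal ultrafilter $\mathfrak u$ on $\mathbb N$, and let ${}^*\mathbb Z\subset{}^*\mathbb R$ be the ultrapowers of $\mathbb Z\subset\mathbb R$. Let ${}^*\mathbb R_{\rm fin}$ be the ring of bounded elements, ${}^*\mathbb R_\varepsilon$ its ideal of infinitesimals, and $({}^*\mathbb R_{\rm fin})^\times_+$ the multiplicative group of positive elements that are neither infinite nor infinitesimal. Let $\mathbb P:=({}^*\mathbb R_{>0}\cup\{0\})/({}^*\mathbb R_{\rm fin})^\times_+$; write $\langle x\rangle\in\mathbb P$ for the class of $|x|$, and $-\infty:=\langle0\rangle$. $\mathbb P$ has the induced product and total order ($\mu<\mu'$ iff $x<x'$ for all representatives; $-\infty$ is the minimum). $\mathbb P_\varepsilon\subset\mathbb P$ is the set of classes of positive infinitesimals. For $0\ne n\in{}^*\mathbb Z$ the growth is $\mu(n):=\langle n\rangle^{-1}$. For $\theta\in\mathbb R$, ${}^*\mathbb Z(\theta)$ is the group of $n\in{}^*\mathbb Z$ for which there is a (unique) $n^\perp\in{}^*\mathbb Z$ with $\varepsilon(n):=n\theta-n^\perp\in{}^*\mathbb R_\varepsilon$; the decay of $n\in{}^*\mathbb Z(\theta)$ is $\nu(n):=\langle\varepsilon(n)\rangle$. For $\mu,\nu\in\mathbb P_\varepsilon$ let $${}^*\mathbb Z^\mu_\nu(\theta):=\{0\neq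 n\in{}^*\mathbb Z(\theta):\ \mu(n)>\mu,\ \nu(n)\le\nu\}\cup\{0\},$$ a subgroup of ${}^*\mathbb Z(\theta)$. The nonvanishing spectrum is ${\rm Spec}(\theta):=\{(\mu,\nu)\in\mathbb P_\varepsilon^2:\ {}^*\mathbb Z^\mu_\nu(\theta)\ne0\}$. *)

theory Defs
  imports "HOL-Analysis.Analysis"
begin

definition nonprincipal_ultrafilter :: "'i filter \<Rightarrow> bool" where
  "nonprincipal_ultrafilter U \<longleftrightarrow>
     U \<noteq> bot \<and>
     (\<forall>P. eventually P U \<or> eventually (\<lambda>n. \<not> P n) U) \<and>
     (\<forall>k. U \<noteq> principal {k})"

text \<open>
  A type cannot depend on the ultrafilter, so elements of an ultrapower are represented as the
  equivalence classes themselves, and every operation takes the ultrafilter as an argument.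
\<close>

type_synonym 'a star = "(nat \<Rightarrow> 'a) set"
type_synonym hyperreal = "real star"

definition star_eq :: "nat filter \<Rightarrow> ((nat \<Rightarrow> 'a) \<times> (nat \<Rightarrow> 'a)) set" where
  "star_eq U = {(x, y). \<forall>\<^sub>F i in U. x i = y i}"

definition star_class :: "nat filter \<Rightarrow> (nat \<Rightarrow> 'a) \<Rightarrow> 'a star" where
  "star_class U x = star_eq U `` {x}"

definition star_of :: "nat filter \<Rightarrow> 'a \<Rightarrow> 'a star" where
  "star_of U a = star_class U (\<lambda>_. a)"

text \<open>The ultrapower of \<open>A\<close>, as a subset of the ultrapower of the ambient type.\<close>

definition ultrapower :: "nat filter \<Rightarrow> 'a set \<Rightarrow> 'a star set" where
  "ultrapower U A = star_class U ` {x. \<forall>i. x i \<in> A}"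

definition star_map :: "nat filter \<Rightarrow> ('a \<Rightarrow> 'b) \<Rightarrow> 'a star \<Rightarrow> 'b star" where
  "star_map U f X = (\<Union>x\<in>X. star_class U (\<lambda>i. f (x i)))"

definition star_map2 ::
  "nat filter \<Rightarrow> ('a \<Rightarrow> 'b \<Rightarrow> 'c) \<Rightarrow> 'a star \<Rightarrow> 'b star \<Rightarrow> 'c star" where
  "star_map2 U f X Y = (\<Union>x\<in>X. \<Union>y\<in>Y. star_class U (\<lambda>i. f (x i) (y i)))"

definition star_rel2 ::
  "nat filter \<Rightarrow> ('a \<Rightarrow> 'b \<Rightarrow> bool) \<Rightarrow> 'a star \<Rightarrow> 'b star \<Rightarrow> bool" where
  "star_rel2 U R X Y \<longleftrightarrow> (\<exists>x\<in>X. \<exists>y\<in>Y. \<forall>\<^sub>F i in U. R (x i) (y i))"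

definition hyperreals :: "nat filter \<Rightarrow> hyperreal set" where
  "hyperreals U = ultrapower U UNIV"

definition hyperints :: "nat filter \<Rightarrow> hyperreal set" where
  "hyperints U = ultrapower U \<int>"

abbreviation hless :: "nat filter \<Rightarrow> hyperreal \<Rightarrow> hyperreal \<Rightarrow> bool" where
  "hless U \<equiv> star_rel2 U (<)"

abbreviation hle :: "nat filter \<Rightarrow> hyperreal \<Rightarrow> hyperreal \<Rightarrow> bool" where
  "hle U \<equiv> star_rel2 U (\<le>)"

abbreviation hmult :: "nat filter \<Rightarrow> hyperreal \<Rightarrow> hyperreal \<Rightarrow> hyperreal" where
  "hmult U \<equiv> star_map2 U (*)"

abbreviation hminus :: "nat filter \<Rightarrow> hyperreal \<Rightarrow> hyperreal \<Rightarrow> hyperreal" where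
  "hminus U \<equiv> star_map2 U (-)"

abbreviation habs :: "nat filter \<Rightarrow> hyperreal \<Rightarrow> hyperreal" where
  "habs U \<equiv> star_map U abs"

definition hfinite :: "nat filter \<Rightarrow> hyperreal set" where
  "hfinite U = {x \<in> hyperreals U. \<exists>r::real. hle U (habs U x) (star_of U r)}"

definition hinfinitesimal :: "nat filter \<Rightarrow> hyperreal set" where
  "hinfinitesimal U =
     {x \<in> hyperreals U. \<forall>r::real. r > 0 \<longrightarrow> hless U (habs U x) (star_of U r)}"

definition hunits_pos :: "nat filter \<Rightarrow> hyperreal set" where
  "hunits_pos U = {x \<in> hfinite U - hinfinitesimal U. hless U (star_of U 0) x}"

text \<open>
  \<open>orbit_class U x\<close> is the class of \<open>\<bar>x\<bar>\<close> modulo the positive units (a single point \<open>{0}\<close>, playing the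
  role of minus infinity, if \<open>x = 0\<close>); \<open>gd U\<close> is the ordered set of all such classes.
\<close>

definition orbit_class :: "nat filter \<Rightarrow> hyperreal \<Rightarrow> hyperreal set" where
  "orbit_class U x = {hmult U (habs U x) u | u. u \<in> hunits_pos U}"

definition gd :: "nat filter \<Rightarrow> hyperreal set set" where
  "gd U = orbit_class U ` {x \<in> hyperreals U. hle U (star_of U 0) x}"

definition gd_less :: "nat filter \<Rightarrow> hyperreal set \<Rightarrow> hyperreal set \<Rightarrow> bool" where
  "gd_less U m m' \<longleftrightarrow> (\<forall>x\<in>m. \<forall>x'\<in>m'. hless U x x')"

definition gd_le :: "nat filter \<Rightarrow> hyperreal set \<Rightarrow> hyperreal set \<Rightarrow> bool" where
  "gd_le U m m' \<longleftrightarrow> gd_less U m m' \<or> m = m'"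

definition gd_inverse :: "nat filter \<Rightarrow> hyperreal set \<Rightarrow> hyperreal set" where
  "gd_inverse U m = star_map U inverse ` m"

definition gd_infinitesimal :: "nat filter \<Rightarrow> hyperreal set set" where
  "gd_infinitesimal U =
     orbit_class U ` {x \<in> hinfinitesimal U. hless U (star_of U 0) x}"

definition growth :: "nat filter \<Rightarrow> hyperreal \<Rightarrow> hyperreal set" where
  "growth U n = gd_inverse U (orbit_class U n)"

definition error_with :: "nat filter \<Rightarrow> real \<Rightarrow> hyperreal \<Rightarrow> hyperreal \<Rightarrow> hyperreal" where
  "error_with U \<theta> n m = hminus U (hmult U n (star_of U \<theta>)) m"

definition dioph :: "nat filter \<Rightarrow> real \<Rightarrow> hyperreal set" where
  "dioph U \<theta> = {n \<in> hyperints U. \<exists>m\<in>hyperints U. error_with U \<theta> n m \<in> hinfinitesimal U}"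

definition perp :: "nat filter \<Rightarrow> real \<Rightarrow> hyperreal \<Rightarrow> hyperreal" where
  "perp U \<theta> n = (THE m. m \<in> hyperints U \<and> error_with U \<theta> n m \<in> hinfinitesimal U)"

definition error :: "nat filter \<Rightarrow> real \<Rightarrow> hyperreal \<Rightarrow> hyperreal" where
  "error U \<theta> n = error_with U \<theta> n (perp U \<theta> n)"

definition decay :: "nat filter \<Rightarrow> real \<Rightarrow> hyperreal \<Rightarrow> hyperreal set" where
  "decay U \<theta> n = orbit_class U (error U \<theta> n)"

definition dioph_gd ::
  "nat filter \<Rightarrow> real \<Rightarrow> hyperreal set \<Rightarrow> hyperreal set \<Rightarrow> hyperreal set" where
  "dioph_gd U \<theta> \<mu> \<nu> =
     {n \<in> dioph U \<theta>. n \<noteq> star_of U 0 \<and> gd_less U \<mu> (growth U n) \<and> gd_le U (decay U \<theta> n) \<nu>}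
     \<union> {star_of U 0}"

definition Spec :: "nat filter \<Rightarrow> real \<Rightarrow> (hyperreal set \<times> hyperreal set) set" where
  "Spec U \<theta> =
     {(\<mu>, \<nu>) \<in> gd_infinitesimal U \<times> gd_infinitesimal U. dioph_gd U \<theta> \<mu> \<nu> \<noteq> {star_of U 0}}"

definition GL2Z :: "(int^2^2) set" where
  "GL2Z = {A. invertible A}"

definition PGL2Z :: "(int^2^2) set set" where
  "PGL2Z = GL2Z // {(A, B). A \<in> GL2Z \<and> B \<in> GL2Z \<and> (\<exists>u. is_unit u \<and> B = mat u ** A)}"

text \<open>The projective line over the reals is \<open>real option\<close>, with \<open>None\<close> the point at infinity.\<close>

fun frac_lin :: "int^2^2 \<Rightarrow> real option \<Rightarrow> real option" where
  "frac_lin A (Some x) =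
     (if of_int (A$2$1) * x + of_int (A$2$2) = 0 then None
      else Some ((of_int (A$1$1) * x + of_int (A$1$2)) / (of_int (A$2$1) * x + of_int (A$2$2))))"
| "frac_lin A None =
     (if A$2$1 = 0 then None else Some (of_int (A$1$1) / of_int (A$2$1)))"

definition PGL2Z_act :: "(int^2^2) set \<Rightarrow> real option \<Rightarrow> real option" where
  "PGL2Z_act M x = the_elem ((\<lambda>A. frac_lin A x) ` M)"


lemma star_class_eq_iff: "star_class U x = star_class U y \<longleftrightarrow> (\<forall>\<^sub>F i in U. x i = y i)"
proof
  assume "star_class U x = star_class U y"
  moreover have "y \<in> star_class U y" by (simp add: star_class_def star_eq_def)
  ultimately have "y \<in> star_class U x" by simp
  then show "\<forall>\<^sub>F i in U. x i = y i" by (simp add: star_class_def star_eq_def)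
next
  assume *: "\<forall>\<^sub>F i in U. x i = y i"
  have "(\<forall>\<^sub>F i in U. x i = z i) \<longleftrightarrow> (\<forall>\<^sub>F i in U. y i = z i)" for z
    using eventually_elim2[OF *, of "\<lambda>i. x i = z i" "\<lambda>i. y i = z i"]
          eventually_elim2[OF *, of "\<lambda>i. y i = z i" "\<lambda>i. x i = z i"] by auto
  then show "star_class U x = star_class U y" by (auto simp: star_class_def star_eq_def)
qed

lemma mem_star_class_iff: "y \<in> star_class U x \<longleftrightarrow> (\<forall>\<^sub>F i in U. x i = y i)"
  by (simp add: star_class_def star_eq_def)

lemma star_map_class: "star_map U f (star_class U x) = star_class U (\<lambda>i. f (x i))"
proof -
  have "star_class U (\<lambda>i. f (x' i)) = star_class U (\<lambda>i. f (x i))" if "x' \<in> star_class U x" for x'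
    using that unfolding mem_star_class_iff star_class_eq_iff by eventually_elim simp
  moreover have "x \<in> star_class U x" by (simp add: mem_star_class_iff)
  ultimately show ?thesis unfolding star_map_def by blast
qed

lemma star_map2_class:
  "star_map2 U f (star_class U x) (star_class U y) = star_class U (\<lambda>i. f (x i) (y i))"
proof -
  have "star_class U (\<lambda>i. f (x' i) (y' i)) = star_class U (\<lambda>i. f (x i) (y i))"
    if "x' \<in> star_class U x" "y' \<in> star_class U y" for x' y'
    using that unfolding mem_star_class_iff star_class_eq_iff by eventually_elim simp
  moreover have "x \<in> star_class U x" "y \<in> star_class U y" by (simp_all add: mem_star_class_iff)
  ultimately show ?thesis unfolding star_map2_def by blast
qed

lemma star_rel2_class:
  "star_rel2 U R (star_class U x) (star_class U y) \<longleftrightarrow> (\<forall>\<^sub>F i in U. R (x i) (y i))"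
proof
  assume "star_rel2 U R (star_class U x) (star_class U y)"
  then obtain x' y' where "\<forall>\<^sub>F i in U. x i = x' i" "\<forall>\<^sub>F i in U. y i = y' i"
      "\<forall>\<^sub>F i in U. R (x' i) (y' i)"
    by (auto simp: star_rel2_def mem_star_class_iff)
  then show "\<forall>\<^sub>F i in U. R (x i) (y i)" by eventually_elim simp
next
  assume "\<forall>\<^sub>F i in U. R (x i) (y i)"
  moreover have "x \<in> star_class U x" "y \<in> star_class U y" by (simp_all add: mem_star_class_iff)
  ultimately show "star_rel2 U R (star_class U x) (star_class U y)"
    unfolding star_rel2_def by blast
qed

lemma perp_unique:
  assumes m: "m \<in> hyperints U" "error_with U \<theta> n m \<in> hinfinitesimal U"
    and m': "m' \<in> hyperints U" "error_with U \<theta> n m' \<in> hinfinitesimal U"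
    and n: "n \<in> hyperints U"
  shows "m = m'"
proof -
  obtain a b c where a: "m = star_class U a" "\<forall>i. a i \<in> \<int>" and b: "m' = star_class U b" "\<forall>i. b i \<in> \<int>"
    and c: "n = star_class U c"
    using m(1) m'(1) n unfolding hyperints_def ultrapower_def by blast
  have "\<forall>\<^sub>F i in U. \<bar>c i * \<theta> - a i\<bar> < 1/2" "\<forall>\<^sub>F i in U. \<bar>c i * \<theta> - b i\<bar> < 1/2"
    using m(2)[unfolded hinfinitesimal_def error_with_def a(1) c star_of_def]
      m'(2)[unfolded hinfinitesimal_def error_with_def b(1) c star_of_def]
    by (auto simp: star_map2_class star_map_class star_rel2_class dest!: spec[of _ "1/2"])
  then have "\<forall>\<^sub>F i in U. a i = b i"
  proof eventually_elim
    case (elim i)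
    then have "\<bar>a i - b i\<bar> < 1" by linarith
    moreover have "a i - b i \<in> \<int>" using a(2) b(2) by simp
    ultimately show ?case using Ints_nonzero_abs_less1 by fastforce
  qed
  then show ?thesis by (simp add: a b star_class_eq_iff)
qed

lemma hunits_pos_iff:
  assumes U: "nonprincipal_ultrafilter U"
  shows "star_class U x \<in> hunits_pos U \<longleftrightarrow>
    (\<exists>r>0. \<exists>s>0. \<forall>\<^sub>F i in U. r \<le> x i \<and> x i \<le> s)"
proof -
  have nb: "U \<noteq> bot" and ult: "\<And>P. eventually P U \<or> eventually (\<lambda>i. \<not> P i) U"
    using U by (simp_all add: nonprincipal_ultrafilter_def)
  have not_ev: "\<not> eventually P U \<longleftrightarrow> eventually (\<lambda>i. \<not> P i) U" for P
  proof -
    have "\<not> (eventually P U \<and> eventually (\<lambda>i. \<not> P i) U)"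
    proof
      assume "eventually P U \<and> eventually (\<lambda>i. \<not> P i) U"
      then have "\<forall>\<^sub>F i in U. P i \<and> \<not> P i" by (simp only: eventually_conj_iff)
      then show False using nb by simp
    qed
    then show ?thesis using ult[of P] by blast
  qed
  have "star_class U x \<in> hunits_pos U \<longleftrightarrow>
    (\<exists>s. \<forall>\<^sub>F i in U. \<bar>x i\<bar> \<le> s) \<and> (\<exists>r>0. \<forall>\<^sub>F i in U. r \<le> \<bar>x i\<bar>) \<and> (\<forall>\<^sub>F i in U. 0 < x i)"
    by (auto simp: hunits_pos_def hfinite_def hinfinitesimal_def hyperreals_def ultrapower_def
        star_of_def star_map_class star_rel2_class not_ev not_less)
  also have "\<dots> \<longleftrightarrow> (\<exists>r>0. \<exists>s>0. \<forall>\<^sub>F i in U. r \<le> x i \<and> x i \<le> s)" (is "?L \<longleftrightarrow> ?R")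
  proof
    assume ?L
    then obtain r s where r: "r > 0" and *: "\<forall>\<^sub>F i in U. \<bar>x i\<bar> \<le> s" "\<forall>\<^sub>F i in U. r \<le> \<bar>x i\<bar>"
      "\<forall>\<^sub>F i in U. 0 < x i" by blast
    from * have ev: "\<forall>\<^sub>F i in U. r \<le> x i \<and> x i \<le> s" by eventually_elim auto
    then obtain i where "r \<le> x i \<and> x i \<le> s" using eventually_happens'[OF nb] by blast
    then have "s > 0" using r by linarith
    with r ev show ?R by blast
  next
    assume ?R
    then obtain r s where r: "r > 0" and *: "\<forall>\<^sub>F i in U. r \<le> x i \<and> x i \<le> s" by blast
    have "\<forall>\<^sub>F i in U. \<bar>x i\<bar> \<le> s" "\<forall>\<^sub>F i in U. r \<le> \<bar>x i\<bar>" "\<forall>\<^sub>F i in U. 0 < x i"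
      by (rule eventually_mono[OF *], use r in linarith)+
    with r show ?L by blast
  qed
  finally show ?thesis .
qed

lemma gd_inverse_class:
  assumes U: "nonprincipal_ultrafilter U" and x: "x \<in> hyperreals U"
  shows "gd_inverse U (orbit_class U x) = orbit_class U (star_map U inverse x)"
proof -
  obtain a where a: "x = star_class U a" using x by (auto simp: hyperreals_def ultrapower_def)
  have inv: "star_class U (\<lambda>i. inverse (u i)) \<in> hunits_pos U"
    if u: "star_class U u \<in> hunits_pos U" for u
  proof -
    obtain r s where rs: "r > 0" "s > 0" "\<forall>\<^sub>F i in U. r \<le> u i \<and> u i \<le> s"
      using u[unfolded hunits_pos_iff[OF U]] by auto
    have "\<forall>\<^sub>F i in U. inverse s \<le> inverse (u i) \<and> inverse (u i) \<le> inverse r"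
      using rs(3) by eventually_elim (use rs in \<open>auto intro!: le_imp_inverse_le\<close>)
    moreover have "inverse s > 0" "inverse r > 0" using rs by simp_all
    ultimately show ?thesis unfolding hunits_pos_iff[OF U] by blast
  qed
  have rep: "orbit_class U (star_class U b) =
      {star_class U (\<lambda>i. \<bar>b i\<bar> * u i) | u. star_class U u \<in> hunits_pos U}" for b
  proof -
    have "\<exists>w. u = star_class U w" if "u \<in> hunits_pos U" for u
      using that by (auto simp: hunits_pos_def hfinite_def hyperreals_def ultrapower_def)
    then have "orbit_class U (star_class U b) =
        {hmult U (habs U (star_class U b)) (star_class U u) | u. star_class U u \<in> hunits_pos U}"
      unfolding orbit_class_def by blast
    then show ?thesis by (simp add: star_map_class star_map2_class)
  qed
  show ?thesis
  proof (intro equalityI subsetI)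
    fix y assume "y \<in> gd_inverse U (orbit_class U x)"
    then obtain u where u: "star_class U u \<in> hunits_pos U"
      and y: "y = star_class U (\<lambda>i. inverse (\<bar>a i\<bar> * u i))"
      by (auto simp: gd_inverse_def a rep star_map_class)
    then have "y = star_class U (\<lambda>i. \<bar>inverse (a i)\<bar> * inverse (u i))"
      by (simp add: mult.commute)
    then show "y \<in> orbit_class U (star_map U inverse x)"
      unfolding a star_map_class rep
      by (intro CollectI exI[of _ "\<lambda>i. inverse (u i)"] conjI inv[OF u])
  next
    fix y assume "y \<in> orbit_class U (star_map U inverse x)"
    then obtain u where u: "star_class U u \<in> hunits_pos U"
      and "y = star_class U (\<lambda>i. \<bar>inverse (a i)\<bar> * u i)"
      by (auto simp: a rep star_map_class)
    then have "y = star_map U inverse (star_class U (\<lambda>i. \<bar>a i\<bar> * inverse (u i)))"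
      by (simp add: star_map_class mult.commute)
    then show "y \<in> gd_inverse U (orbit_class U x)"
      unfolding gd_inverse_def a rep
      by (intro image_eqI CollectI exI[of _ "\<lambda>i. inverse (u i)"] conjI inv[OF u]) auto
  qed
qed

lemma gd_infinitesimal_subset: "gd_infinitesimal U \<subseteq> gd U"
proof -
  have "hle U z x" if "hless U z x" for z x
  proof -
    from that obtain z' x' where "z' \<in> z" "x' \<in> x" and *: "\<forall>\<^sub>F i in U. z' i < x' i"
      by (auto simp: star_rel2_def)
    moreover from * have "\<forall>\<^sub>F i in U. z' i \<le> x' i" by eventually_elim simp
    ultimately show ?thesis unfolding star_rel2_def by blast
  qed
  then show ?thesis by (auto simp: gd_infinitesimal_def gd_def hinfinitesimal_def)
qed

lemma frac_lin_scalar: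
  assumes "is_unit u" shows "frac_lin (mat u ** A) x = frac_lin A x"
proof -
  have u: "u = 1 \<or> u = -1" using assms by (auto simp: zdvd1_eq)
  have "mat u ** A = (\<chi> i j. u * A$i$j)"
    by (simp add: vec_eq_iff matrix_matrix_mult_def mat_def if_distrib[of "\<lambda>x. x * _"] cong: if_cong)
  then show ?thesis using u
    by (cases x) (auto simp: divide_simps, simp add: algebra_simps)
qed

lemma PGL2Z_act_rep:
  assumes M: "M \<in> PGL2Z" and A: "A \<in> M"
  shows "PGL2Z_act M x = frac_lin A x"
proof -
  obtain B where B: "M = {C. B \<in> GL2Z \<and> C \<in> GL2Z \<and> (\<exists>u. is_unit u \<and> C = mat u ** B)}"
    using M unfolding PGL2Z_def quotient_def by auto
  have "frac_lin C x = frac_lin B x" if "C \<in> M" for C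
    using that B frac_lin_scalar by auto
  then have "(\<lambda>C. frac_lin C x) ` M = {frac_lin A x}" using A by auto
  then show ?thesis by (simp add: PGL2Z_act_def)
qed

end

theory Submission
  imports Defs
begin

text \<open>
  In terms of representatives, a pair of classes \<open>(\<langle>x\<rangle>, \<langle>y\<rangle>)\<close> lies in the spectrum of \<open>\<theta>\<close> iff there are
  integer sequences \<open>n \<noteq> 0\<close> and \<open>m\<close> such that \<open>n x\<close> and \<open>\<epsilon> = n \<theta> - m\<close> are infinitesimal and \<open>\<epsilon> / y\<close>
  is bounded. If \<open>\<eta> = (a \<theta> + b) / (c \<theta> + d)\<close>, then \<open>n' = c m + d n\<close> and \<open>m' = a m + b n\<close> satisfy
  \<open>n' = (c \<theta> + d) n - c \<epsilon>\<close> and \<open>n' \<eta> - m' = (a - c \<eta>) \<epsilon>\<close>, so growth and decay change only by bounded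
  factors and the spectrum of \<open>\<theta>\<close> is contained in that of \<open>\<eta>\<close>. The inverse matrix gives the converse.
\<close>

section \<open>Passing from ultrapower elements to representing sequences\<close>

lemma not_eventually_ultrafilter:
  assumes "nonprincipal_ultrafilter U"
  shows "\<not> eventually P U \<longleftrightarrow> (\<forall>\<^sub>F i in U. \<not> P i)"
proof -
  have "\<not> (eventually P U \<and> (\<forall>\<^sub>F i in U. \<not> P i))"
    using assms eventually_conj[of P U "\<lambda>i. \<not> P i"]
    by (auto simp: nonprincipal_ultrafilter_def)
  then show ?thesis
    using assms by (auto simp: nonprincipal_ultrafilter_def)
qed

lemma hyperints_iff: "X \<in> hyperints U \<longleftrightarrow> (\<exists>n. X = star_class U n \<and> (\<forall>i. n i \<in> \<int>))"
  by (auto simp: hyperints_def ultrapower_def)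

lemma hinfinitesimal_class:
  "star_class U x \<in> hinfinitesimal U \<longleftrightarrow> (\<forall>r>0. \<forall>\<^sub>F i in U. \<bar>x i\<bar> < r)"
  by (auto simp: hinfinitesimal_def hyperreals_def ultrapower_def star_of_def star_map_class
      star_rel2_class)

lemma error_with_class:
  "error_with U \<theta> (star_class U n) (star_class U m) = star_class U (\<lambda>i. n i * \<theta> - m i)"
  by (simp add: error_with_def star_of_def star_map2_class)

text \<open>\<open>perp\<close> is a definite description. Two integers whose errors are both
  infinitesimal differ by less than 1, hence agree (\<open>perp_unique\<close>), so any witness
  \<open>m\<close> may be used to compute the error.\<close>

lemma error_eq:
  assumes "n \<in> hyperints U" "m \<in> hyperints U" "error_with U \<theta> n m \<in> hinfinitesimal U"
  shows "error U \<theta> n = error_with U \<theta> n m"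
proof -
  have "perp U \<theta> n = m"
    unfolding perp_def
  proof (rule the_equality)
    show "m \<in> hyperints U \<and> error_with U \<theta> n m \<in> hinfinitesimal U" using assms by simp
    show "m' = m" if "m' \<in> hyperints U \<and> error_with U \<theta> n m' \<in> hinfinitesimal U" for m'
      by (rule perp_unique[OF conjunct1[OF that] conjunct2[OF that] assms(2,3,1)])
  qed
  then show ?thesis by (simp add: error_def)
qed

section \<open>Classes modulo positive units and their order\<close>

lemma orbit_class_class:
  "orbit_class U (star_class U b) =
     {star_class U (\<lambda>i. \<bar>b i\<bar> * u i) | u. star_class U u \<in> hunits_pos U}"
proof -
  have "\<exists>w. u = star_class U w" if "u \<in> hunits_pos U" for u
    using that by (auto simp: hunits_pos_def hfinite_def hyperreals_def ultrapower_def)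
  then have "orbit_class U (star_class U b) =
      {hmult U (habs U (star_class U b)) (star_class U u) | u. star_class U u \<in> hunits_pos U}"
    unfolding orbit_class_def by blast
  then show ?thesis by (simp add: star_map_class star_map2_class)
qed

lemma orbit_class_memI:
  assumes "star_class U u \<in> hunits_pos U"
  shows "star_class U (\<lambda>i. \<bar>b i\<bar> * u i) \<in> orbit_class U (star_class U b)"
  unfolding orbit_class_class by (intro CollectI exI[of _ u] conjI refl assms)

lemma const_in_hunits_pos:
  assumes "nonprincipal_ultrafilter U" "r > 0"
  shows "star_class U (\<lambda>_. r) \<in> hunits_pos U"
  unfolding hunits_pos_iff[OF assms(1)] using assms(2) by (intro exI[of _ r]) auto

text \<open>Units are bounded above and below by positive reals, so comparing all pairs of
  representatives amounts to absorbing an arbitrary real factor \<open>C\<close>: the strict order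
  says that \<open>a\<close> is infinitely smaller than \<open>b\<close>.\<close>

lemma gd_less_orbit_class_iff:
  assumes U: "nonprincipal_ultrafilter U"
  shows "gd_less U (orbit_class U (star_class U a)) (orbit_class U (star_class U b)) \<longleftrightarrow>
    (\<forall>C>0. \<forall>\<^sub>F i in U. C * \<bar>a i\<bar> < \<bar>b i\<bar>)" (is "?L \<longleftrightarrow> ?R")
proof
  assume L: ?L
  show ?R
  proof (intro allI impI)
    fix C :: real assume "C > 0"
    then have "star_class U (\<lambda>i. \<bar>a i\<bar> * C) \<in> orbit_class U (star_class U a)"
      "star_class U (\<lambda>i. \<bar>b i\<bar> * 1) \<in> orbit_class U (star_class U b)"
      by (intro orbit_class_memI const_in_hunits_pos[OF U]; simp)+
    then have "hless U (star_class U (\<lambda>i. \<bar>a i\<bar> * C)) (star_class U (\<lambda>i. \<bar>b i\<bar> * 1))"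
      using L unfolding gd_less_def by blast
    then show "\<forall>\<^sub>F i in U. C * \<bar>a i\<bar> < \<bar>b i\<bar>"
      by (simp add: star_rel2_class mult.commute)
  qed
next
  assume R: ?R
  have "\<forall>\<^sub>F i in U. \<bar>a i\<bar> * u i < \<bar>b i\<bar> * v i"
    if uv: "star_class U u \<in> hunits_pos U" "star_class U v \<in> hunits_pos U" for u v
  proof -
    obtain s where s: "s > 0" "\<forall>\<^sub>F i in U. u i \<le> s"
      using uv(1)[unfolded hunits_pos_iff[OF U]] by (auto simp: eventually_conj_iff)
    obtain r where r: "r > 0" "\<forall>\<^sub>F i in U. r \<le> v i"
      using uv(2)[unfolded hunits_pos_iff[OF U]] by (auto simp: eventually_conj_iff)
    \<comment> \<open>The ratio \<open>u i / v i\<close> is at most \<open>s / r\<close> almost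
      everywhere, so this one instance of the hypothesis covers both units at once.\<close>
    have "\<forall>\<^sub>F i in U. (s / r) * \<bar>a i\<bar> < \<bar>b i\<bar>" using R divide_pos_pos[OF s(1) r(1)] by blast
    with s(2) r(2) show ?thesis
    proof eventually_elim
      case (elim i)
      have "\<bar>a i\<bar> * u i \<le> \<bar>a i\<bar> * s" using elim by (simp add: mult_left_mono)
      also have "\<dots> < \<bar>b i\<bar> * r" using elim r by (simp add: field_simps)
      also have "\<dots> \<le> \<bar>b i\<bar> * v i" using elim by (simp add: mult_left_mono)
      finally show ?case .
    qed
  qed
  then show ?L by (auto simp: gd_less_def orbit_class_class star_rel2_class)
qed

text \<open>The positive units form a group, so multiplication and division by \<open>w\<close>
  carry representatives of either class to representatives of the other.\<close>

lemma orbit_class_eqI: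
  assumes U: "nonprincipal_ultrafilter U"
    and w: "star_class U w \<in> hunits_pos U"
    and a: "\<forall>\<^sub>F i in U. \<bar>a i\<bar> = \<bar>b i\<bar> * w i"
  shows "orbit_class U (star_class U a) = orbit_class U (star_class U b)"
proof -
  obtain r s where rs: "r > 0" "s > 0" "\<forall>\<^sub>F i in U. r \<le> w i \<and> w i \<le> s"
    using w[unfolded hunits_pos_iff[OF U]] by blast
  have mult: "star_class U (\<lambda>i. w i * u i) \<in> hunits_pos U"
    and quot: "star_class U (\<lambda>i. u i / w i) \<in> hunits_pos U"
    if u: "star_class U u \<in> hunits_pos U" for u
  proof -
    obtain r' s' where rs': "r' > 0" "s' > 0" "\<forall>\<^sub>F i in U. r' \<le> u i \<and> u i \<le> s'"
      using u[unfolded hunits_pos_iff[OF U]] by blast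
    have "\<forall>\<^sub>F i in U. r * r' \<le> w i * u i \<and> w i * u i \<le> s * s'"
      using rs(3) rs'(3) by eventually_elim (use rs rs' in \<open>auto intro!: mult_mono\<close>)
    then show "star_class U (\<lambda>i. w i * u i) \<in> hunits_pos U"
      unfolding hunits_pos_iff[OF U] using rs rs' mult_pos_pos by blast
    have "\<forall>\<^sub>F i in U. r' / s \<le> u i / w i \<and> u i / w i \<le> s' / r"
      using rs(3) rs'(3) by eventually_elim (use rs rs' in \<open>auto intro!: frac_le\<close>)
    then show "star_class U (\<lambda>i. u i / w i) \<in> hunits_pos U"
      unfolding hunits_pos_iff[OF U] using rs rs' divide_pos_pos by blast
  qed
  show ?thesis
  proof (intro equalityI subsetI)
    fix z assume "z \<in> orbit_class U (star_class U a)"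
    then obtain u where u: "star_class U u \<in> hunits_pos U" "z = star_class U (\<lambda>i. \<bar>a i\<bar> * u i)"
      unfolding orbit_class_class by blast
    have "z = star_class U (\<lambda>i. \<bar>b i\<bar> * (w i * u i))"
      unfolding u(2) star_class_eq_iff using a by eventually_elim simp
    then show "z \<in> orbit_class U (star_class U b)"
      using orbit_class_memI[OF mult[OF u(1)]] by simp
  next
    fix z assume "z \<in> orbit_class U (star_class U b)"
    then obtain u where u: "star_class U u \<in> hunits_pos U" "z = star_class U (\<lambda>i. \<bar>b i\<bar> * u i)"
      unfolding orbit_class_class by blast
    have "z = star_class U (\<lambda>i. \<bar>a i\<bar> * (u i / w i))"
      \<comment> \<open>The lower bound \<open>r\<close> keeps \<open>w i\<close> away from 0, which
        allows cancelling it.\<close>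
      unfolding u(2) star_class_eq_iff using a rs(3) by eventually_elim (use rs in simp)
    then show "z \<in> orbit_class U (star_class U a)"
      using orbit_class_memI[OF quot[OF u(1)]] by simp
  qed
qed

text \<open>The substance is the direction from right to left. If \<open>a\<close> is dominated by a
  real multiple of \<open>b\<close> without being infinitely smaller, then the quotient of absolute
  values lies between two positive reals; it is a unit and the classes coincide.\<close>

lemma gd_le_orbit_class_iff:
  assumes U: "nonprincipal_ultrafilter U" and b: "\<forall>\<^sub>F i in U. b i \<noteq> 0"
  shows "gd_le U (orbit_class U (star_class U a)) (orbit_class U (star_class U b)) \<longleftrightarrow>
    (\<exists>C>0. \<forall>\<^sub>F i in U. \<bar>a i\<bar> \<le> C * \<bar>b i\<bar>)" (is "?L \<longleftrightarrow> ?R")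
proof
  assume ?L
  then consider "gd_less U (orbit_class U (star_class U a)) (orbit_class U (star_class U b))"
    | "orbit_class U (star_class U a) = orbit_class U (star_class U b)"
    unfolding gd_le_def by blast
  then show ?R
  proof cases
    case 1
    then have "\<forall>\<^sub>F i in U. 1 * \<bar>a i\<bar> < \<bar>b i\<bar>"
      unfolding gd_less_orbit_class_iff[OF U] using zero_less_one by blast
    then have "\<forall>\<^sub>F i in U. \<bar>a i\<bar> \<le> 1 * \<bar>b i\<bar>" by eventually_elim simp
    then show ?thesis using zero_less_one by blast
  next
    case 2
    \<comment> \<open>The unit 1 places the class of |a| itself in the common orbit, so it is also
      |b| times some unit, whose upper bound serves as \<open>C\<close>.\<close>
    have "star_class U (\<lambda>i. \<bar>a i\<bar> * 1) \<in> orbit_class U (star_class U a)"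
      by (intro orbit_class_memI const_in_hunits_pos[OF U] zero_less_one)
    then obtain u where u: "star_class U u \<in> hunits_pos U" "\<forall>\<^sub>F i in U. \<bar>a i\<bar> = \<bar>b i\<bar> * u i"
      unfolding 2 by (auto simp: orbit_class_class star_class_eq_iff)
    obtain s where s: "s > 0" "\<forall>\<^sub>F i in U. u i \<le> s"
      using u(1)[unfolded hunits_pos_iff[OF U]] by (auto simp: eventually_conj_iff)
    have "\<forall>\<^sub>F i in U. \<bar>a i\<bar> \<le> s * \<bar>b i\<bar>"
      using u(2) s(2) by eventually_elim (simp add: mult.commute mult_right_mono)
    then show ?thesis using s(1) by blast
  qed
next
  assume ?R
  then obtain C where C: "C > 0" "\<forall>\<^sub>F i in U. \<bar>a i\<bar> \<le> C * \<bar>b i\<bar>" by blast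
  show ?L
  proof (cases "gd_less U (orbit_class U (star_class U a)) (orbit_class U (star_class U b))")
    case True
    then show ?thesis by (simp add: gd_le_def)
  next
    case False
    \<comment> \<open>The negated criterion gives one \<open>D\<close> for which the inequality does
      not hold almost everywhere. The ultrafilter turns this into failure almost everywhere, that is
      |b| \<le> D |a|, which yields the lower bound 1 / D on the quotient.\<close>
    then obtain D where D: "D > 0" "\<forall>\<^sub>F i in U. \<not> D * \<bar>a i\<bar> < \<bar>b i\<bar>"
      unfolding gd_less_orbit_class_iff[OF U] not_eventually_ultrafilter[OF U, symmetric] by blast
    have "\<forall>\<^sub>F i in U. 1 / D \<le> \<bar>a i\<bar> / \<bar>b i\<bar> \<and> \<bar>a i\<bar> / \<bar>b i\<bar> \<le> C"
      using b C(2) D(2) by eventually_elim (use D(1) in \<open>auto simp: field_simps\<close>)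
    moreover have "1 / D > 0" using D by simp
    ultimately have "star_class U (\<lambda>i. \<bar>a i\<bar> / \<bar>b i\<bar>) \<in> hunits_pos U"
      unfolding hunits_pos_iff[OF U] using C(1) by blast
    moreover have "\<forall>\<^sub>F i in U. \<bar>a i\<bar> = \<bar>b i\<bar> * (\<bar>a i\<bar> / \<bar>b i\<bar>)"
      using b by eventually_elim simp
    ultimately have "orbit_class U (star_class U a) = orbit_class U (star_class U b)"
      by (rule orbit_class_eqI[OF U])
    then show ?thesis by (simp add: gd_le_def)
  qed
qed

section \<open>Growth, decay and the spectrum in terms of integer sequences\<close>

lemma gd_less_growth_iff:
  assumes U: "nonprincipal_ultrafilter U" and n: "\<forall>\<^sub>F i in U. n i \<noteq> 0"
  shows "gd_less U (orbit_class U (star_class U x)) (growth U (star_class U n)) \<longleftrightarrow>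
    (\<forall>C>0. \<forall>\<^sub>F i in U. C * \<bar>x i\<bar> * \<bar>n i\<bar> < 1)"
proof -
  have "star_class U n \<in> hyperreals U" by (auto simp: hyperreals_def ultrapower_def)
  \<comment> \<open>Inverting a class elementwise gives the class of the inverse, so the order
    criterion applies to \<open>x\<close> and 1 / n; multiplying by |n| then clears the
    denominator.\<close>
  then have "growth U (star_class U n) = orbit_class U (star_class U (\<lambda>i. inverse (n i)))"
    by (simp add: growth_def gd_inverse_class[OF U] star_map_class)
  moreover have "(\<forall>\<^sub>F i in U. C * \<bar>x i\<bar> < \<bar>inverse (n i)\<bar>) \<longleftrightarrow> (\<forall>\<^sub>F i in U. C * \<bar>x i\<bar> * \<bar>n i\<bar> < 1)"
    for C
    by (rule eventually_cong[OF n]) (simp add: field_simps)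
  ultimately show ?thesis by (simp add: gd_less_orbit_class_iff[OF U])
qed

text \<open>This removes the ultrapower from the problem: what remains to be transported between
  \<theta> and \<eta> are estimates on integer sequences that hold almost everywhere.\<close>

lemma dioph_gd_nontrivial_iff:
  assumes U: "nonprincipal_ultrafilter U" and y: "\<forall>\<^sub>F i in U. y i \<noteq> 0"
  shows "dioph_gd U \<theta> (orbit_class U (star_class U x)) (orbit_class U (star_class U y))
      \<noteq> {star_of U 0} \<longleftrightarrow>
    (\<exists>n m. (\<forall>i. n i \<in> \<int>) \<and> (\<forall>i. m i \<in> \<int>) \<and> (\<forall>\<^sub>F i in U. n i \<noteq> 0) \<and>
      (\<forall>r>0. \<forall>\<^sub>F i in U. \<bar>n i * \<theta> - m i\<bar> < r) \<and>
      (\<forall>C>0. \<forall>\<^sub>F i in U. C * \<bar>x i\<bar> * \<bar>n i\<bar> < 1) \<and>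
      (\<exists>C>0. \<forall>\<^sub>F i in U. \<bar>n i * \<theta> - m i\<bar> \<le> C * \<bar>y i\<bar>))" (is "?L \<longleftrightarrow> ?R")
proof -
  let ?X = "orbit_class U (star_class U x)" and ?Y = "orbit_class U (star_class U y)"
  \<comment> \<open>Being a nonzero class means only that \<open>n i = 0\<close> does not hold
    almost everywhere; the ultrafilter upgrades this to \<open>n i\<close> being nonzero almost
    everywhere.\<close>
  have nz: "star_class U n \<noteq> star_of U 0 \<longleftrightarrow> (\<forall>\<^sub>F i in U. n i \<noteq> 0)" for n :: "nat \<Rightarrow> real"
    by (simp add: star_of_def star_class_eq_iff not_eventually_ultrafilter[OF U])
  have decay: "gd_le U (decay U \<theta> (star_class U n)) ?Y \<longleftrightarrow>
      (\<exists>C>0. \<forall>\<^sub>F i in U. \<bar>n i * \<theta> - m i\<bar> \<le> C * \<bar>y i\<bar>)"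
    if "\<forall>i. n i \<in> \<int>" "\<forall>i. m i \<in> \<int>" "\<forall>r>0. \<forall>\<^sub>F i in U. \<bar>n i * \<theta> - m i\<bar> < r" for n m
  proof -
    have "error U \<theta> (star_class U n) = error_with U \<theta> (star_class U n) (star_class U m)"
      using that by (intro error_eq) (auto simp: hyperints_iff error_with_class hinfinitesimal_class)
    then show ?thesis
      by (simp add: decay_def error_with_class gd_le_orbit_class_iff[OF U y])
  qed
  have "?L \<longleftrightarrow> (\<exists>N \<in> dioph U \<theta>. N \<noteq> star_of U 0 \<and> gd_less U ?X (growth U N) \<and>
      gd_le U (decay U \<theta> N) ?Y)"
    unfolding dioph_gd_def by blast
  also have "\<dots> \<longleftrightarrow> (\<exists>n m. (\<forall>i. n i \<in> \<int>) \<and> (\<forall>i. m i \<in> \<int>) \<and>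
      (\<forall>r>0. \<forall>\<^sub>F i in U. \<bar>n i * \<theta> - m i\<bar> < r) \<and> star_class U n \<noteq> star_of U 0 \<and>
      gd_less U ?X (growth U (star_class U n)) \<and> gd_le U (decay U \<theta> (star_class U n)) ?Y)"
    (is "?M \<longleftrightarrow> ?N")
  proof
    assume ?M
    then obtain N M where "N \<in> hyperints U" "M \<in> hyperints U"
      and *: "error_with U \<theta> N M \<in> hinfinitesimal U" "N \<noteq> star_of U 0"
        "gd_less U ?X (growth U N)" "gd_le U (decay U \<theta> N) ?Y"
      unfolding dioph_def by blast
    then obtain n m where nm: "N = star_class U n" "\<forall>i. n i \<in> \<int>" "M = star_class U m" "\<forall>i. m i \<in> \<int>"
      unfolding hyperints_iff by blast
    show ?N
      using nm(2,4) * unfolding nm(1,3) error_with_class hinfinitesimal_class by blast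
  next
    assume ?N
    then obtain n m where nm: "\<forall>i. n i \<in> \<int>" "\<forall>i. m i \<in> \<int>"
        "\<forall>r>0. \<forall>\<^sub>F i in U. \<bar>n i * \<theta> - m i\<bar> < r"
      and *: "star_class U n \<noteq> star_of U 0"
        "gd_less U ?X (growth U (star_class U n))" "gd_le U (decay U \<theta> (star_class U n)) ?Y"
      by blast
    have "star_class U n \<in> hyperints U" "star_class U m \<in> hyperints U"
      "error_with U \<theta> (star_class U n) (star_class U m) \<in> hinfinitesimal U"
      using nm by (auto simp: hyperints_iff error_with_class hinfinitesimal_class)
    then have "star_class U n \<in> dioph U \<theta>" unfolding dioph_def by blast
    then show ?M using * by blast
  qed
  also have "\<dots> \<longleftrightarrow> ?R"
  proof (intro ex_cong1)
    fix n m
    show "((\<forall>i. n i \<in> \<int>) \<and> (\<forall>i. m i \<in> \<int>) \<and>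
        (\<forall>r>0. \<forall>\<^sub>F i in U. \<bar>n i * \<theta> - m i\<bar> < r) \<and> star_class U n \<noteq> star_of U 0 \<and>
        gd_less U ?X (growth U (star_class U n)) \<and> gd_le U (decay U \<theta> (star_class U n)) ?Y) \<longleftrightarrow>
      ((\<forall>i. n i \<in> \<int>) \<and> (\<forall>i. m i \<in> \<int>) \<and> (\<forall>\<^sub>F i in U. n i \<noteq> 0) \<and>
        (\<forall>r>0. \<forall>\<^sub>F i in U. \<bar>n i * \<theta> - m i\<bar> < r) \<and>
        (\<forall>C>0. \<forall>\<^sub>F i in U. C * \<bar>x i\<bar> * \<bar>n i\<bar> < 1) \<and>
        (\<exists>C>0. \<forall>\<^sub>F i in U. \<bar>n i * \<theta> - m i\<bar> \<le> C * \<bar>y i\<bar>))"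
      (is "(?A \<and> ?B \<and> ?S \<and> ?Z \<and> ?G \<and> ?D) \<longleftrightarrow> (_ \<and> _ \<and> ?Z' \<and> _ \<and> ?G' \<and> ?D')")
    proof -
      have "?Z \<longleftrightarrow> ?Z'" by (rule nz)
      \<comment> \<open>The translations of growth and decay are valid only under the other
        conjuncts, hence the conditional equivalences.\<close>
      moreover have "?Z' \<Longrightarrow> ?G \<longleftrightarrow> ?G'" by (rule gd_less_growth_iff[OF U])
      moreover have "?A \<Longrightarrow> ?B \<Longrightarrow> ?S \<Longrightarrow> ?D \<longleftrightarrow> ?D'" by (rule decay)
      ultimately show ?thesis by argo
    qed
  qed
  finally show ?thesis .
qed

section \<open>Transport of the spectrum along a fractional linear map\<close>

lemma Spec_subset_frac_lin:
  fixes a b c d :: int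
  assumes U: "nonprincipal_ultrafilter U"
    and nz: "of_int c * \<theta> + of_int d \<noteq> 0"
    and eq: "\<eta> * (of_int c * \<theta> + of_int d) = of_int a * \<theta> + of_int b"
  shows "Spec U \<theta> \<subseteq> Spec U \<eta>"
proof clarify
  fix \<mu> \<nu> assume "(\<mu>, \<nu>) \<in> Spec U \<theta>"
  then have gd: "\<mu> \<in> gd_infinitesimal U" "\<nu> \<in> gd_infinitesimal U"
    and S: "dioph_gd U \<theta> \<mu> \<nu> \<noteq> {star_of U 0}"
    unfolding Spec_def by auto
  obtain x where x: "\<mu> = orbit_class U (star_class U x)"
    using gd(1) by (auto simp: gd_infinitesimal_def hinfinitesimal_def hyperreals_def ultrapower_def)
  \<comment> \<open>Positivity of \<open>y\<close> is kept, because the sequence criterion asks for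
    a representative that is nonzero almost everywhere.\<close>
  obtain y where y: "\<nu> = orbit_class U (star_class U y)" and "\<forall>\<^sub>F i in U. 0 < y i"
    using gd(2) by (auto simp: gd_infinitesimal_def hinfinitesimal_def hyperreals_def ultrapower_def
        star_of_def star_rel2_class)
  from this(2) have y0: "\<forall>\<^sub>F i in U. y i \<noteq> 0" by eventually_elim simp
  obtain n m where int: "\<forall>i. n i \<in> \<int>" "\<forall>i. m i \<in> \<int>" and n0: "\<forall>\<^sub>F i in U. n i \<noteq> 0"
    and small: "\<forall>r>0. \<forall>\<^sub>F i in U. \<bar>n i * \<theta> - m i\<bar> < r"
    and growth: "\<forall>C>0. \<forall>\<^sub>F i in U. C * \<bar>x i\<bar> * \<bar>n i\<bar> < 1"
    and decay: "\<exists>C>0. \<forall>\<^sub>F i in U. \<bar>n i * \<theta> - m i\<bar> \<le> C * \<bar>y i\<bar>"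
    using S[unfolded x y dioph_gd_nontrivial_iff[OF U y0]] by blast
  define n' where "n' i = of_int c * m i + of_int d * n i" for i
  define m' where "m' i = of_int a * m i + of_int b * n i" for i
  define k where "k = of_int c * \<theta> + of_int d"
  \<comment> \<open>The summand 1 makes \<open>l\<close> positive even if the factor vanishes, so
    that dividing by \<open>l\<close> is legitimate below.\<close>
  define l where "l = \<bar>of_int a - of_int c * \<eta>\<bar> + 1"
  have l: "l > 0" by (simp add: l_def)
  have n'_eq: "n' i = k * n i - of_int c * (n i * \<theta> - m i)" for i
    by (simp add: n'_def k_def algebra_simps)
  have err: "n' i * \<eta> - m' i = (of_int a - of_int c * \<eta>) * (n i * \<theta> - m i)" for i
  proof -
    \<comment> \<open>The terms in \<open>m i\<close> cancel, and what is left is \<open>n i\<close>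
      times the defect of the relation \<open>eq\<close>.\<close>
    have "n' i * \<eta> - m' i - (of_int a - of_int c * \<eta>) * (n i * \<theta> - m i) =
        n i * (\<eta> * (of_int c * \<theta> + of_int d) - (of_int a * \<theta> + of_int b))"
      by (simp add: n'_def m'_def algebra_simps)
    then show ?thesis using eq by simp
  qed
  have err_le: "\<bar>n' i * \<eta> - m' i\<bar> \<le> l * \<bar>n i * \<theta> - m i\<bar>" for i
    unfolding err abs_mult by (intro mult_right_mono) (auto simp: l_def)
  \<comment> \<open>Integrality enters here: a nonzero integer dominates every error below
    1.\<close>
  have n1: "\<forall>\<^sub>F i in U. 1 \<le> \<bar>n i\<bar>"
    using n0 by eventually_elim (use int Ints_nonzero_abs_ge1 in blast)
  have "\<forall>i. n' i \<in> \<int>" "\<forall>i. m' i \<in> \<int>"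
    using int by (auto simp: n'_def m'_def)
  moreover have "\<forall>\<^sub>F i in U. n' i \<noteq> 0"
  proof -
    \<comment> \<open>The threshold makes the correction \<open>c * (n i * \<theta> - m i)\<close>
      smaller than |k|, hence smaller than the main term \<open>k * n i\<close>, so
      \<open>n' i\<close> cannot vanish. The summand 1 avoids division by 0 when c = 0.\<close>
    have "\<bar>k\<bar> / (\<bar>of_int c\<bar> + 1) > 0" using nz by (simp add: k_def)
    then have "\<forall>\<^sub>F i in U. \<bar>n i * \<theta> - m i\<bar> < \<bar>k\<bar> / (\<bar>of_int c\<bar> + 1)" using small by blast
    with n1 show ?thesis
    proof eventually_elim
      case (elim i)
      have "\<bar>of_int c * (n i * \<theta> - m i)\<bar> \<le> (\<bar>of_int c\<bar> + 1) * \<bar>n i * \<theta> - m i\<bar>"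
        by (simp add: abs_mult mult_right_mono)
      also have "\<dots> < \<bar>k\<bar>" using elim(2) by (simp add: field_simps)
      also have "\<dots> \<le> \<bar>k * n i\<bar>"
        using mult_left_mono[OF elim(1), of "\<bar>k\<bar>"] by (simp add: abs_mult)
      finally show ?case by (auto simp: n'_eq)
    qed
  qed
  moreover have "\<forall>r>0. \<forall>\<^sub>F i in U. \<bar>n' i * \<eta> - m' i\<bar> < r"
  proof (intro allI impI)
    fix r :: real assume "r > 0"
    then have "\<forall>\<^sub>F i in U. \<bar>n i * \<theta> - m i\<bar> < r / l" using small l by simp
    then show "\<forall>\<^sub>F i in U. \<bar>n' i * \<eta> - m' i\<bar> < r"
    proof eventually_elim
      case (elim i)
      then have "l * \<bar>n i * \<theta> - m i\<bar> < r" using l by (simp add: field_simps)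
      then show ?case using err_le[of i] by linarith
    qed
  qed
  moreover have "\<forall>C>0. \<forall>\<^sub>F i in U. C * \<bar>x i\<bar> * \<bar>n' i\<bar> < 1"
  proof (intro allI impI)
    fix C :: real assume C: "C > 0"
    \<comment> \<open>Almost everywhere the error is below 1 and |n| is at least 1, so the
      correction is at most |c| |n| and |n'| \<le> K |n|. Applying the growth condition with
      \<open>C * K\<close> absorbs this factor.\<close>
    define K where "K = \<bar>k\<bar> + \<bar>of_int c\<bar>"
    have "K > 0" using nz by (simp add: K_def k_def)
    then have "\<forall>\<^sub>F i in U. (C * K) * \<bar>x i\<bar> * \<bar>n i\<bar> < 1" using growth C by simp
    moreover have "\<forall>\<^sub>F i in U. \<bar>n i * \<theta> - m i\<bar> < 1" using small by simp
    ultimately show "\<forall>\<^sub>F i in U. C * \<bar>x i\<bar> * \<bar>n' i\<bar> < 1" using n1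
    proof eventually_elim
      case (elim i)
      have "\<bar>n' i\<bar> \<le> \<bar>k\<bar> * \<bar>n i\<bar> + \<bar>of_int c\<bar> * \<bar>n i * \<theta> - m i\<bar>"
        unfolding n'_eq abs_mult[symmetric] by (rule abs_triangle_ineq4)
      also have "\<dots> \<le> \<bar>k\<bar> * \<bar>n i\<bar> + \<bar>of_int c\<bar> * \<bar>n i\<bar>"
        using elim by (intro add_left_mono mult_left_mono) auto
      finally have "\<bar>n' i\<bar> \<le> K * \<bar>n i\<bar>" by (simp add: K_def algebra_simps)
      then have "C * \<bar>x i\<bar> * \<bar>n' i\<bar> \<le> C * \<bar>x i\<bar> * (K * \<bar>n i\<bar>)"
        using C by (intro mult_left_mono) auto
      then show ?case using elim(1) by (simp add: mult_ac)
    qed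
  qed
  moreover have "\<exists>C>0. \<forall>\<^sub>F i in U. \<bar>n' i * \<eta> - m' i\<bar> \<le> C * \<bar>y i\<bar>"
  proof -
    obtain C where C: "C > 0" "\<forall>\<^sub>F i in U. \<bar>n i * \<theta> - m i\<bar> \<le> C * \<bar>y i\<bar>" using decay by blast
    from C(2) have "\<forall>\<^sub>F i in U. \<bar>n' i * \<eta> - m' i\<bar> \<le> (l * C) * \<bar>y i\<bar>"
    proof eventually_elim
      case (elim i)
      then have "l * \<bar>n i * \<theta> - m i\<bar> \<le> l * (C * \<bar>y i\<bar>)" using l by simp
      then show ?case using err_le[of i] by (simp add: mult.assoc)
    qed
    moreover have "l * C > 0" using l C by simp
    ultimately show ?thesis by blast
  qed
  ultimately have "dioph_gd U \<eta> \<mu> \<nu> \<noteq> {star_of U 0}"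
    unfolding x y dioph_gd_nontrivial_iff[OF U y0] by blast
  then show "(\<mu>, \<nu>) \<in> Spec U \<eta>"
    using gd by (simp add: Spec_def)
qed

text \<open>The determinant of an invertible integer matrix divides 1. This keeps the denominator of
  the inverse transformation away from 0.\<close>

lemma GL2Z_det_nonzero:
  assumes "A \<in> GL2Z"
  shows "A$1$1 * A$2$2 - A$1$2 * A$2$1 \<noteq> 0"
proof -
  obtain B where "A ** B = mat 1" using assms by (auto simp: GL2Z_def invertible_def)
  then have "det A * det B = 1" by (metis det_mul det_I)
  then show ?thesis by (auto simp: det_2)
qed

theorem proposition7:
  fixes U :: "nat filter" and \<theta> \<eta> :: real
  assumes "nonprincipal_ultrafilter U"
    and "\<exists>A\<in>PGL2Z. PGL2Z_act A (Some \<theta>) = Some \<eta>"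
  shows "Spec U \<theta> = Spec U \<eta>"
proof -
  obtain M where M: "M \<in> PGL2Z" "PGL2Z_act M (Some \<theta>) = Some \<eta>" using assms(2) by blast
  then obtain A where A: "A \<in> GL2Z" "A \<in> M"
  proof -
    obtain B where B: "B \<in> GL2Z"
      "M = {C. B \<in> GL2Z \<and> C \<in> GL2Z \<and> (\<exists>u. is_unit u \<and> C = mat u ** B)}"
      using M(1) unfolding PGL2Z_def quotient_def by auto
    \<comment> \<open>The unit 1 shows that the projective class contains the matrix it was built
      from.\<close>
    have "B = mat 1 ** B" by simp
    then have "B \<in> M" using B by (metis (mono_tags, lifting) mem_Collect_eq one_dvd)
    with B(1) show ?thesis by (rule that)
  qed
  define a b c d where "a = A$1$1" "b = A$1$2" "c = A$2$1" "d = A$2$2"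
  have "frac_lin A (Some \<theta>) = Some \<eta>" using PGL2Z_act_rep[OF M(1) A(2)] M(2) by simp
  \<comment> \<open>The value \<open>Some \<eta>\<close> rules out the point at infinity, so the
    denominator is nonzero and can be cleared.\<close>
  then have nz: "of_int c * \<theta> + of_int d \<noteq> 0"
    and eq: "\<eta> * (of_int c * \<theta> + of_int d) = of_int a * \<theta> + of_int b"
    by (auto simp: a_b_c_d_def split: if_splits)
  have "real_of_int (a * d - b * c) \<noteq> 0"
    using GL2Z_det_nonzero[OF A(1)] unfolding a_b_c_d_def of_int_eq_0_iff .
  \<comment> \<open>The adjugate, with rows (d, -b) and (-c, a), represents the inverse
    transformation. Its denominator at \<eta> times the original one at \<theta> equals the
    determinant, so neither factor vanishes.\<close>
  moreover have "(of_int (- c) * \<eta> + of_int a) * (of_int c * \<theta> + of_int d) = real_of_int (a * d - b * c)"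
    using arg_cong[OF eq, of "\<lambda>t. of_int c * t"] by (simp add: algebra_simps)
  ultimately have nz': "of_int (- c) * \<eta> + of_int a \<noteq> 0" by auto
  have eq': "\<theta> * (of_int (- c) * \<eta> + of_int a) = of_int d * \<eta> + of_int (- b)"
    using eq by (simp add: algebra_simps)
  show ?thesis
    using Spec_subset_frac_lin[OF assms(1) nz eq] Spec_subset_frac_lin[OF assms(1) nz' eq'] by blast
qed

end
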